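(* There is an absolute constant $C>0$ such that for every integer $k\geq1$, every $\rho\in(0,1]$, every distance parameter $\varepsilon\in(0,1]$ and every $\delta\in(0,1)$, there exists a private-coin $\rho$-LDP protocol for $(k,\varepsilon,\delta)$-independence testing in which each player sends a single bit, using $n=C\frac{k^3}{\varepsilon^2\rho^2}\log\frac1\delta$ players.
   Context: $[k]=\{1,\dots,k\}$; $d_{TV}(\mathbf{p},\mathbf{q})=\frac12\sum_x|\mathbf{p}(x)-\mathbf{q}(x)|$; for distributions $\mathbf{q}_1,\mathbf{q}_2$ on $[k]$, $\mathbf{q}_1\otimes\mathbf{q}_2$ is the product distribution on $[k]\times[k]$. A channel $W$ is $\rho$-locally differentially private ($\rho$-LDP) if $W(y\mid x')\leq e^{\rho}W(y\mid x)$ for all outputs $y$ and inputs $x,x'$. Setting: $n$ players, player $i$ holds $X_i$, with $X_1,\dots,X_n$ i.i.d. from an unknown distribution $\mathbf{p}$ on $[k]\times[k]$ with marginals $\mathbf{p}_1,\mathbf{p}_2$. In a private-coin (non-interactive) protocol each player $i$ chooses a $\rho$-LDP channel $W_i$ (possibly depending on its own private randomness, independent across players and of the samples) and simultaneously sends the message $Y_i$ obtained by passing $X_i$ through $W_i$ to a referee, who applies a (possibly randomized) map to $(Y_1,\dots,Y_n)$ outputting accept or reject. One bit per player means $Y_i\in\{0,1\}$. The protocol solves $(k,\varepsilon,\delta)$-independence testing if it accepts with probability $>1-\delta$ whenever $\mathbf{p}=\mathbf{p}_1\otimes\mathbf{p}_2$, and rejects with probability $>1-\delta$ whenever $\inf_{\mathbf{q}_1,\mathbf{q}_2}d_{TV}(\mathbf{p},\mathbf{q}_1\otimes\mathbf{q}_2)>\varepsilon$,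 the infimum over distributions on $[k]$. *)

theory Defs
  imports "HOL-Probability.Probability"
begin

definition square :: "nat \<Rightarrow> (nat \<times> nat) set" where
  "square k = {1..k} \<times> {1..k}"

definition distributions :: "'x set \<Rightarrow> 'x pmf set" where
  "distributions A = {p. set_pmf p \<subseteq> A}"

definition tv_dist :: "'x set \<Rightarrow> 'x pmf \<Rightarrow> 'x pmf \<Rightarrow> real" where
  "tv_dist A p q = 1 / 2 * (\<Sum>x\<in>A. \<bar>pmf p x - pmf q x\<bar>)"

definition dist_to_products :: "nat \<Rightarrow> (nat \<times> nat) pmf \<Rightarrow> real" where
  "dist_to_products k p =
     (INF (q1, q2) \<in> distributions {1..k} \<times> distributions {1..k}.
        tv_dist (square k) p (pair_pmf q1 q2))"

definition ldp :: "real \<Rightarrow> 'x set \<Rightarrow> ('x \<Rightarrow> 'y pmf) \<Rightarrow> bool" where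
  "ldp \<rho> A W \<longleftrightarrow> (\<forall>x\<in>A. \<forall>x'\<in>A. \<forall>y. pmf (W x') y \<le> exp \<rho> * pmf (W x) y)"

text \<open>
  A non-interactive private-coin protocol with inputs in \<open>'x\<close>, private randomness in \<open>'s\<close> and
  messages in \<open>'y\<close>. Player \<open>i\<close> draws a seed \<open>s\<close> from \<open>coins i\<close> and uses the channel
  \<open>channel i s\<close>; the referee sees the messages only, and \<open>True\<close> means accept.
\<close>

record ('x, 's, 'y) protocol =
  coins :: "nat \<Rightarrow> 's pmf"
  channel :: "nat \<Rightarrow> 's \<Rightarrow> 'x \<Rightarrow> 'y pmf"
  referee :: "(nat \<Rightarrow> 'y) \<Rightarrow> bool pmf"

definition ldp_protocol :: "real \<Rightarrow> 'x set \<Rightarrow> nat \<Rightarrow> ('x, 's, 'y) protocol \<Rightarrow> bool" where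
  "ldp_protocol \<rho> A n P \<longleftrightarrow>
     (\<forall>i\<in>{1..n}. \<forall>s\<in>set_pmf (coins P i). ldp \<rho> A (channel P i s))"

text \<open>
  Seeds, samples and messages are vectors indexed by the players \<open>{1..n}\<close>, set to \<open>undefined\<close>
  elsewhere.
\<close>

definition run_protocol :: "nat \<Rightarrow> ('x, 's, 'y) protocol \<Rightarrow> 'x pmf \<Rightarrow> bool pmf" where
  "run_protocol n P p =
     do {
       s \<leftarrow> Pi_pmf {1..n} undefined (coins P);
       x \<leftarrow> Pi_pmf {1..n} undefined (\<lambda>_. p);
       y \<leftarrow> Pi_pmf {1..n} undefined (\<lambda>i. channel P i (s i) (x i));
       referee P y
     }"

definition solves_independence_testing ::
  "nat \<Rightarrow> real \<Rightarrow> real \<Rightarrow> nat \<Rightarrow> (nat \<times> nat, 's, 'y) protocol \<Rightarrow> bool" where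
  "solves_independence_testing k \<epsilon> \<delta> n P \<longleftrightarrow>
     (\<forall>p\<in>distributions (square k).
        (p = pair_pmf (map_pmf fst p) (map_pmf snd p) \<longrightarrow>
           pmf (run_protocol n P p) True > 1 - \<delta>) \<and>
        (dist_to_products k p > \<epsilon> \<longrightarrow>
           pmf (run_protocol n P p) False > 1 - \<delta>))"

end

theory Submission
  imports Defs
begin

text \<open>
  Let \<open>\<Delta> = p - p\<^sub>1 \<otimes> p\<^sub>2\<close> and let \<open>N\<close> be a power of two with \<open>k < N \<le> 2 k\<close>. In the Hadamard basis the
  coefficients of \<open>\<Delta>\<close> are covariances \<open>a\<^sub>j = E[h\<^sub>1 h\<^sub>2] - E[h\<^sub>1] E[h\<^sub>2]\<close> of signs, and Parseval gives
  \<open>\<parallel>\<Delta>\<parallel>\<^sub>2\<^sup>2 = N\<^sup>-\<^sup>2 \<Sum>\<^sub>j a\<^sub>j\<^sup>2\<close>. Each of the three expectations is estimated by its own \<open>m\<close> players using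
  randomized response, so no marginal has to be learned beforehand. Two independent copies \<open>A\<^sub>j, B\<^sub>j\<close>
  of the resulting unbiased estimate of \<open>a\<^sub>j\<close>, of variance \<open>O(1 / (m \<rho>\<^sup>2))\<close>, make
  \<open>N\<^sup>-\<^sup>2 \<Sum>\<^sub>j A\<^sub>j B\<^sub>j\<close> an unbiased estimate of \<open>\<parallel>\<Delta>\<parallel>\<^sub>2\<^sup>2\<close>, which vanishes for product distributions and by
  Cauchy--Schwarz is at least \<open>4 \<epsilon>\<^sup>2 / k\<^sup>2\<close> for distributions far from products. Chebyshev's inequality
  shows that \<open>m = O(k / (\<rho>\<^sup>2 \<epsilon>\<^sup>2))\<close> is enough for constant error, and a majority vote over
  \<open>O(log (1 / \<delta>))\<close> rounds brings the error below \<open>\<delta>\<close>. For \<open>\<delta> > 1 / 2\<close>, where the number of players may be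
  as small as one, the referee flips a fair coin.
\<close>

subsection \<open>Moments and tails of independent variables\<close>

text \<open>Finite support makes every real function integrable, so the moment identities carry no
  integrability conditions. Vectors of one-bit messages satisfy it.\<close>

locale finite_pmf =
  fixes Q :: "'w pmf"
  assumes finite_support: "finite (set_pmf Q)"
begin

abbreviation E :: "('w \<Rightarrow> real) \<Rightarrow> real" where
  "E f \<equiv> measure_pmf.expectation Q f"

definition Var :: "('w \<Rightarrow> real) \<Rightarrow> real" where
  "Var f = measure_pmf.variance Q f"

abbreviation indep :: "('i \<Rightarrow> 'w \<Rightarrow> real) \<Rightarrow> 'i set \<Rightarrow> bool" where
  "indep \<equiv> prob_space.indep_vars (measure_pmf Q) (\<lambda>_. borel)"

lemma integrable [simp, intro]: "integrable (measure_pmf Q) (f :: 'w \<Rightarrow> real)"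
  by (rule integrable_measure_pmf_finite[OF finite_support])

lemma Var_eq: "Var f = E (\<lambda>w. (f w)\<^sup>2) - (E f)\<^sup>2"
  unfolding Var_def by (rule measure_pmf.variance_eq) auto

lemma expectation_prod:
  assumes "indep X I" "J \<subseteq> I" "finite J" "\<And>i. i \<in> J \<Longrightarrow> f i \<in> borel_measurable borel"
  shows "E (\<lambda>w. \<Prod>i\<in>J. f i (X i w)) = (\<Prod>i\<in>J. E (\<lambda>w. f i (X i w)))"
proof -
  have "indep (\<lambda>i w. f i (X i w)) J"
    by (rule prob_space.indep_vars_compose2[OF prob_space_measure_pmf
          prob_space.indep_vars_subset[OF prob_space_measure_pmf assms(1,2)]]) (rule assms(4))
  thus ?thesis
    using assms(3) by (intro prob_space.indep_vars_lebesgue_integral[OF prob_space_measure_pmf]) auto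
qed

lemma expectation_mult:
  assumes "indep X I" "i \<in> I" "j \<in> I" "i \<noteq> j"
    "f \<in> borel_measurable borel" "g \<in> borel_measurable borel"
  shows "E (\<lambda>w. f (X i w) * g (X j w)) = E (\<lambda>w. f (X i w)) * E (\<lambda>w. g (X j w))"
  using expectation_prod[OF assms(1), of "{i, j}" "\<lambda>t. if t = i then f else g"] assms(2-6)
  by (auto split: if_splits)

text \<open>Blocks with disjoint index sets depend on disjoint families of independent variables.
  Applied repeatedly, this lifts independence from players to block means, covariance estimates and
  rounds.\<close>

lemma indep_group:
  assumes X: "indep X (A \<times> B)"
    and F: "F \<in> borel_measurable (PiM B (\<lambda>_. borel))"
  shows "indep (\<lambda>t w. F (\<lambda>b\<in>B. X (t, b) w)) A"
proof -
  have "prob_space.indep_vars (measure_pmf Q) (\<lambda>t. PiM ({t} \<times> B) (\<lambda>_. borel))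
      (\<lambda>t w. \<lambda>i\<in>{t} \<times> B. X i w) A"
    by (rule prob_space.indep_vars_restrict[OF prob_space_measure_pmf X]) (auto simp: disjoint_family_on_def)
  moreover have "(\<lambda>z. F (\<lambda>b\<in>B. z (t, b))) \<in> borel_measurable (PiM ({t} \<times> B) (\<lambda>_. borel))" for t
    by (rule measurable_compose[OF _ F]) (auto intro!: measurable_restrict measurable_component_singleton)
  ultimately have "indep (\<lambda>t w. F (\<lambda>b\<in>B. (\<lambda>i\<in>{t} \<times> B. X i w) (t, b))) A"
    by (rule prob_space.indep_vars_compose2[OF prob_space_measure_pmf, where Y = "\<lambda>t z. F (\<lambda>b\<in>B. z (t, b))"])
  moreover have "(\<lambda>b\<in>B. (\<lambda>i\<in>{t} \<times> B. X i w) (t, b)) = (\<lambda>b\<in>B. X (t, b) w)" for t w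
    by (auto simp: fun_eq_iff)
  ultimately show ?thesis by simp
qed

lemma Var_sum:
  assumes "indep X I" "finite I"
  shows "Var (\<lambda>w. \<Sum>i\<in>I. X i w) = (\<Sum>i\<in>I. Var (X i))"
proof -
  have "E (\<lambda>w. (\<Sum>i\<in>I. X i w)\<^sup>2) = (\<Sum>i\<in>I. \<Sum>j\<in>I. E (\<lambda>w. X i w * X j w))"
    by (simp add: power2_eq_square sum_product)
  also have "\<dots> = (\<Sum>i\<in>I. \<Sum>j\<in>I. E (X i) * E (X j) + (if i = j then Var (X i) else 0))"
    using expectation_mult[OF assms(1), of _ _ "\<lambda>x. x" "\<lambda>x. x"]
    by (intro sum.cong refl) (auto simp: Var_eq power2_eq_square)
  also have "\<dots> = (\<Sum>i\<in>I. E (X i))\<^sup>2 + (\<Sum>i\<in>I. Var (X i))"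
    using assms(2) by (simp add: sum.distrib power2_eq_square sum_product)
  finally show ?thesis
    by (simp add: Var_eq)
qed

lemma Var_cmult: "Var (\<lambda>w. c * f w) = c\<^sup>2 * Var f"
  by (simp add: Var_eq power_mult_distrib algebra_simps)

lemma Var_nonneg: "Var f \<ge> 0"
  unfolding Var_def by (rule measure_pmf.variance_positive)

lemma Chebyshev: "a > 0 \<Longrightarrow> measure_pmf.prob Q {w. \<bar>f w - E f\<bar> \<ge> a} \<le> Var f / a\<^sup>2"
  using measure_pmf.Chebyshev_inequality[of f Q a] by (simp add: Var_def)

lemma Markov:
  assumes "\<And>w. u w \<ge> 0" "c > 0"
  shows "measure_pmf.prob Q {w. u w \<ge> c} \<le> E u / c"
  using integral_Markov_inequality_measure[of "measure_pmf Q" u UNIV c] assms by simp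

text \<open>Chernoff bound via the moment \<open>9 ^ S\<close> of the number \<open>S\<close> of failures.\<close>

lemma majority_error:
  fixes R :: nat
  assumes ind: "indep T {..<R}"
    and B: "B \<in> sets borel"
    and err: "\<And>r. r < R \<Longrightarrow> measure_pmf.prob Q {w. T r w \<in> B} \<le> 1 / 10"
  shows "measure_pmf.prob Q {w. R \<le> 2 * card {r. r < R \<and> T r w \<in> B}} \<le> (3 / 5) ^ R"
proof -
  define S where "S w = card {r. r < R \<and> T r w \<in> B}" for w
  \<comment> \<open>\<open>g\<close> is 9 on a failure and 1 otherwise. For failure probability p =
    1/10 the base s = (1 - p) / p = 9 minimises the bound per round (1 - p + p s) / sqrt s, whose
    value is then 3/5.\<close>
  define g where "g t = 1 + 8 * (indicator B t :: real)" for t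
  have g: "(\<Prod>r<R. g (T r w)) = 9 ^ S w" for w
  proof -
    have "(\<Prod>r<R. g (T r w)) = (\<Prod>r\<in>{..<R}. if T r w \<in> B then 9 else 1)"
      by (intro prod.cong) (auto simp: g_def)
    also have "\<dots> = (\<Prod>r\<in>{r \<in> {..<R}. T r w \<in> B}. 9)"
      by (rule prod.inter_filter[symmetric]) auto
    also have "\<dots> = 9 ^ S w" by (simp add: S_def)
    finally show ?thesis .
  qed
  have "E (\<lambda>w. g (T r w)) \<le> 9 / 5" if "r < R" for r
  proof -
    have "E (\<lambda>w. g (T r w)) = 1 + 8 * E (indicator {w. T r w \<in> B})"
      by (simp add: g_def indicator_def[abs_def])
    thus ?thesis using err[OF that] by simp
  qed
  moreover have "E (\<lambda>w. g (T r w)) \<ge> 0" for r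
    by (intro integral_nonneg_AE) (auto simp: g_def)
  ultimately have "(\<Prod>r<R. E (\<lambda>w. g (T r w))) \<le> (\<Prod>r<R. 9 / 5)"
    by (intro prod_mono) auto
  moreover have "E (\<lambda>w. 9 ^ S w) = (\<Prod>r<R. E (\<lambda>w. g (T r w)))"
    unfolding g[symmetric] using B
    by (intro expectation_prod[OF ind]) (auto simp: g_def)
  ultimately have bound: "E (\<lambda>w. 9 ^ S w) \<le> (9 / 5) ^ R" by simp
  have "{w. R \<le> 2 * S w} \<subseteq> {w. 3 ^ R \<le> (9 ^ S w :: real)}"
  proof safe
    fix w assume "R \<le> 2 * S w"
    hence "(3::real) ^ R \<le> 3 ^ (2 * S w)" by (intro power_increasing) auto
    thus "3 ^ R \<le> (9 ^ S w :: real)" by (simp add: power_mult)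
  qed
  hence "measure_pmf.prob Q {w. R \<le> 2 * S w} \<le> measure_pmf.prob Q {w. 3 ^ R \<le> (9 ^ S w :: real)}"
    by (intro measure_pmf.finite_measure_mono) auto
  also have "\<dots> \<le> E (\<lambda>w. 9 ^ S w) / 3 ^ R"
    by (intro Markov) auto
  also have "\<dots> \<le> (9 / 5) ^ R / 3 ^ R"
    using bound by (intro divide_right_mono) auto
  also have "\<dots> = (3 / 5) ^ R" by (simp flip: power_divide)
  finally show ?thesis by (simp add: S_def)
qed

text \<open>Privacy noise shrinks the mean of each reported sign by \<open>g\<close>. Dividing by
  \<open>g\<close> restores it and multiplies the variance, at most 1 per sign, by
  \<open>1 / g^2\<close>.\<close>

lemma moments_mean:
  fixes m :: nat and g \<mu> :: real
  assumes "indep Y {..<m}" "m > 0" "g > 0"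
    and "\<And>l w. l < m \<Longrightarrow> \<bar>Y l w\<bar> \<le> 1"
    and "\<And>l. l < m \<Longrightarrow> E (Y l) = g * \<mu>"
  shows "E (\<lambda>w. 1 / (m * g) * (\<Sum>l<m. Y l w)) = \<mu>"
    and "Var (\<lambda>w. 1 / (m * g) * (\<Sum>l<m. Y l w)) \<le> 1 / (m * g\<^sup>2)"
proof -
  show "E (\<lambda>w. 1 / (m * g) * (\<Sum>l<m. Y l w)) = \<mu>"
    using assms by simp
  have "Var (Y l) \<le> 1" if "l < m" for l
  proof -
    have "E (\<lambda>w. (Y l w)\<^sup>2) \<le> E (\<lambda>w. 1)"
      using assms(4)[OF that] by (intro integral_mono) (auto simp: abs_square_le_1)
    also have "E (\<lambda>w. 1) = 1" by simp
    finally show ?thesis unfolding Var_eq using zero_le_power2[of "E (Y l)"] by linarith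
  qed
  hence "Var (\<lambda>w. \<Sum>l<m. Y l w) \<le> m"
    using sum_mono[of "{..<m}" "\<lambda>l. Var (Y l)" "\<lambda>_. 1"] by (simp add: Var_sum[OF assms(1)])
  hence "Var (\<lambda>w. 1 / (m * g) * (\<Sum>l<m. Y l w)) \<le> (1 / (m * g))\<^sup>2 * m"
    unfolding Var_cmult by (intro mult_left_mono) auto
  also have "\<dots> = 1 / (m * g\<^sup>2)"
    using assms(2,3) by (simp add: power2_eq_square field_simps)
  finally show "Var (\<lambda>w. 1 / (m * g) * (\<Sum>l<m. Y l w)) \<le> 1 / (m * g\<^sup>2)" .
qed

text \<open>Independence makes the product of the two marginal estimates unbiased, with variance V1
  V2 + V1 e2^2 + V2 e1^2 for variances V and means e. With the variance of \<open>Z 0\<close> these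
  are four terms, each at most \<open>v\<close>.\<close>

lemma moments_covariance:
  assumes ind: "indep Z {..<3::nat}"
    and var: "\<And>c. c < 3 \<Longrightarrow> Var (Z c) \<le> v" and v: "v \<le> 1"
    and mean: "\<bar>E (Z 1)\<bar> \<le> 1" "\<bar>E (Z 2)\<bar> \<le> 1"
  shows "E (\<lambda>w. Z 0 w - Z 1 w * Z 2 w) = E (Z 0) - E (Z 1) * E (Z 2)"
    and "Var (\<lambda>w. Z 0 w - Z 1 w * Z 2 w) \<le> 4 * v"
proof -
  \<comment> \<open>Exponents 0, 1 and 2 extract every mixed moment needed below from this one
    identity.\<close>
  have prod: "E (\<lambda>w. \<Prod>c<3. Z c w ^ e c) = (\<Prod>c<3. E (\<lambda>w. Z c w ^ e c))" for e :: "nat \<Rightarrow> nat"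
    by (rule expectation_prod[OF ind]) auto
  note simps = numeral_3_eq_3 lessThan_Suc mult_ac
  have E12: "E (\<lambda>w. Z 1 w * Z 2 w) = E (Z 1) * E (Z 2)"
    using prod[of "\<lambda>c. if c = 0 then 0 else 1"] by (simp add: simps numeral_2_eq_2)
  have E012: "E (\<lambda>w. Z 0 w * (Z 1 w * Z 2 w)) = E (Z 0) * (E (Z 1) * E (Z 2))"
    using prod[of "\<lambda>c. 1"] by (simp add: simps numeral_2_eq_2)
  have E1122: "E (\<lambda>w. (Z 1 w * Z 2 w)\<^sup>2) = E (\<lambda>w. (Z 1 w)\<^sup>2) * E (\<lambda>w. (Z 2 w)\<^sup>2)"
    using prod[of "\<lambda>c. if c = 0 then 0 else 2"]
    by (simp add: simps power_mult_distrib) (simp add: numeral_2_eq_2 mult_ac)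
  show mean': "E (\<lambda>w. Z 0 w - Z 1 w * Z 2 w) = E (Z 0) - E (Z 1) * E (Z 2)"
    using E12 by simp
  have "E (\<lambda>w. (Z 0 w - Z 1 w * Z 2 w)\<^sup>2)
      = E (\<lambda>w. (Z 0 w)\<^sup>2) - 2 * E (\<lambda>w. Z 0 w * (Z 1 w * Z 2 w)) + E (\<lambda>w. (Z 1 w * Z 2 w)\<^sup>2)"
    by (simp add: power2_diff mult_ac)
  hence "Var (\<lambda>w. Z 0 w - Z 1 w * Z 2 w)
      = Var (Z 0) + Var (Z 1) * Var (Z 2) + Var (Z 1) * (E (Z 2))\<^sup>2 + Var (Z 2) * (E (Z 1))\<^sup>2"
    unfolding Var_eq mean' E012 E1122 by (simp add: power2_eq_square algebra_simps)
  moreover have "Var (Z 1) * Var (Z 2) \<le> v * 1"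
    using var[of 1] var[of 2] v Var_nonneg[of "Z 1"] Var_nonneg[of "Z 2"] by (intro mult_mono) linarith+
  moreover have "Var (Z 1) * (E (Z 2))\<^sup>2 \<le> v * 1" "Var (Z 2) * (E (Z 1))\<^sup>2 \<le> v * 1"
    using var[of 1] var[of 2] Var_nonneg[of "Z 1"] Var_nonneg[of "Z 2"] mean
    by (intro mult_mono; simp add: abs_square_le_1)+
  ultimately show "Var (\<lambda>w. Z 0 w - Z 1 w * Z 2 w) \<le> 4 * v"
    using var[of 0] by simp
qed

text \<open>The square of a single estimate would be biased by its variance; the product of two
  independent copies is not. The variance of such a product is at most
  \<open>(v + a^2)^2 - a^4\<close>, which is \<open>v^2 + 2 v a^2\<close>.\<close>

lemma moments_squared_norm:
  fixes a :: "'j \<Rightarrow> real" and v :: real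
  assumes ind: "indep A (J \<times> (UNIV :: bool set))" and J: "finite J"
    and mean: "\<And>j b. j \<in> J \<Longrightarrow> E (A (j, b)) = a j"
    and var: "\<And>j b. j \<in> J \<Longrightarrow> Var (A (j, b)) \<le> v"
  shows "E (\<lambda>w. \<Sum>j\<in>J. A (j, False) w * A (j, True) w) = (\<Sum>j\<in>J. (a j)\<^sup>2)"
    and "Var (\<lambda>w. \<Sum>j\<in>J. A (j, False) w * A (j, True) w)
      \<le> card J * v\<^sup>2 + 2 * v * (\<Sum>j\<in>J. (a j)\<^sup>2)"
proof -
  have m: "E (\<lambda>w. A (j, False) w * A (j, True) w) = (a j)\<^sup>2" if "j \<in> J" for j
    using expectation_mult[OF ind, of "(j, False)" "(j, True)" "\<lambda>x. x" "\<lambda>x. x"] that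
    by (simp add: mean power2_eq_square)
  thus "E (\<lambda>w. \<Sum>j\<in>J. A (j, False) w * A (j, True) w) = (\<Sum>j\<in>J. (a j)\<^sup>2)" by simp
  have "indep (\<lambda>j w. A (j, False) w * A (j, True) w) J"
    using indep_group[OF ind, of "\<lambda>z. z False * z True"] by simp
  hence "Var (\<lambda>w. \<Sum>j\<in>J. A (j, False) w * A (j, True) w)
      = (\<Sum>j\<in>J. Var (\<lambda>w. A (j, False) w * A (j, True) w))"
    by (rule Var_sum[OF _ J])
  also have "\<dots> \<le> (\<Sum>j\<in>J. v\<^sup>2 + 2 * v * (a j)\<^sup>2)"
  proof (rule sum_mono)
    fix j assume j: "j \<in> J"
    have sq: "E (\<lambda>w. (A (j, b) w)\<^sup>2) = Var (A (j, b)) + (a j)\<^sup>2" for b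
      using mean[OF j] by (simp add: Var_eq)
    have "E (\<lambda>w. (A (j, False) w * A (j, True) w)\<^sup>2)
        = (Var (A (j, False)) + (a j)\<^sup>2) * (Var (A (j, True)) + (a j)\<^sup>2)"
      using expectation_mult[OF ind, of "(j, False)" "(j, True)" "\<lambda>x. x\<^sup>2" "\<lambda>x. x\<^sup>2"] j
      by (simp add: power_mult_distrib sq)
    also have "\<dots> \<le> (v + (a j)\<^sup>2) * (v + (a j)\<^sup>2)"
      using var[OF j, of True] var[OF j, of False] Var_nonneg[of "A (j, True)"]
        Var_nonneg[of "A (j, False)"]
      by (intro mult_mono) (auto intro: add_nonneg_nonneg)
    finally show "Var (\<lambda>w. A (j, False) w * A (j, True) w) \<le> v\<^sup>2 + 2 * v * (a j)\<^sup>2"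
      unfolding Var_eq m[OF j] by (simp add: power2_eq_square algebra_simps)
  qed
  also have "\<dots> = card J * v\<^sup>2 + 2 * v * (\<Sum>j\<in>J. (a j)\<^sup>2)"
    by (simp add: sum.distrib sum_distrib_left)
  finally show "Var (\<lambda>w. \<Sum>j\<in>J. A (j, False) w * A (j, True) w)
      \<le> card J * v\<^sup>2 + 2 * v * (\<Sum>j\<in>J. (a j)\<^sup>2)" .
qed

end

subsection \<open>The statistic of one round\<close>

text \<open>
  The player with index \<open>(((r, j, b), c), l)\<close> works in round \<open>r\<close> on the Hadamard coefficient \<open>j\<close>, for
  the copy \<open>b\<close> of its estimate, in the role \<open>c < 3\<close>, and is number \<open>l < m\<close> of its block.
\<close>

definition block_mean :: "nat \<Rightarrow> real \<Rightarrow> ('u \<times> nat \<Rightarrow> real) \<Rightarrow> 'u \<Rightarrow> real" where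
  "block_mean m g y u = 1 / (m * g) * (\<Sum>l<m. y (u, l))"

definition covariance_estimate ::
  "nat \<Rightarrow> real \<Rightarrow> (('t \<times> nat) \<times> nat \<Rightarrow> real) \<Rightarrow> 't \<Rightarrow> real" where
  "covariance_estimate m g y t =
     block_mean m g y (t, 0) - block_mean m g y (t, 1) * block_mean m g y (t, 2)"

text \<open>When \<open>J\<close> consists of all index pairs, Parseval makes the mean of the sum
  \<open>card J\<close> times the squared norm to be estimated; hence the normalisation.\<close>

definition round_statistic ::
  "nat \<Rightarrow> real \<Rightarrow> 'j set \<Rightarrow> ((('r \<times> ('j \<times> bool)) \<times> nat) \<times> nat \<Rightarrow> real) \<Rightarrow> 'r \<Rightarrow> real" where
  "round_statistic m g J y r = 1 / card J *
     (\<Sum>j\<in>J. covariance_estimate m g y (r, j, False) * covariance_estimate m g y (r, j, True))"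

context finite_pmf
begin

lemma indep_section:
  assumes "indep X (A \<times> B)" "t \<in> A"
  shows "indep (\<lambda>b. X (t, b)) B"
proof -
  have "prob_space.indep_vars (measure_pmf Q) (\<lambda>b. PiM {(t, b)} (\<lambda>_. borel))
      (\<lambda>b w. \<lambda>i\<in>{(t, b)}. X i w) B"
    using assms(2)
    by (intro prob_space.indep_vars_restrict[OF prob_space_measure_pmf assms(1)])
      (auto simp: disjoint_family_on_def)
  hence "indep (\<lambda>b w. (\<lambda>i\<in>{(t, b)}. X i w) (t, b)) B"
    by (rule prob_space.indep_vars_compose2[OF prob_space_measure_pmf,
          where Y = "\<lambda>b z. z (t, b)"]) auto
  thus ?thesis by simp
qed

lemma moments_round_statistic:
  fixes Y :: "((nat \<times> ('j \<times> bool)) \<times> nat) \<times> nat \<Rightarrow> 'w \<Rightarrow> real" and g :: real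
  assumes ind: "indep Y ((({..<R} \<times> (J \<times> UNIV)) \<times> {..<3}) \<times> {..<m})"
    and J: "finite J" "J \<noteq> {}" and m: "m > 0" and g: "g > 0" "1 / (m * g\<^sup>2) \<le> 1"
    and bounded: "\<And>i w. \<bar>Y i w\<bar> \<le> 1"
    and mean: "\<And>r j b c l. r < R \<Longrightarrow> j \<in> J \<Longrightarrow> c < 3 \<Longrightarrow> l < m \<Longrightarrow>
      E (Y (((r, j, b), c), l)) = g * \<mu> j c"
    and \<mu>: "\<And>j c. j \<in> J \<Longrightarrow> \<bar>\<mu> j c\<bar> \<le> 1"
  defines "T \<equiv> \<lambda>r w. round_statistic m g J (\<lambda>i. Y i w) r"
    and "D \<equiv> 1 / card J * (\<Sum>j\<in>J. (\<mu> j 0 - \<mu> j 1 * \<mu> j 2)\<^sup>2)"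
    and "v \<equiv> 4 / (m * g\<^sup>2)"
  shows "indep T {..<R}"
    and "r < R \<Longrightarrow> E (T r) = D"
    and "r < R \<Longrightarrow> Var (T r) \<le> (v\<^sup>2 + 2 * v * D) / card J"
proof -
  define Z where "Z u w = block_mean m g (\<lambda>i. Y i w) u" for u w
  define A where "A t w = covariance_estimate m g (\<lambda>i. Y i w) t" for t w
  have A_Z: "A t = (\<lambda>w. Z (t, 0) w - Z (t, 1) w * Z (t, 2) w)" for t
    by (simp add: A_def Z_def covariance_estimate_def fun_eq_iff)
  have T_A: "T r = (\<lambda>w. 1 / card J * (\<Sum>j\<in>J. A (r, j, False) w * A (r, j, True) w))" for r
    by (simp add: T_def A_def round_statistic_def fun_eq_iff)

  have Z_ind: "indep Z (({..<R} \<times> (J \<times> UNIV)) \<times> {..<3})"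
    using indep_group[OF ind, of "\<lambda>z. 1 / (m * g) * (\<Sum>l<m. z l)"]
    by (simp add: Z_def[abs_def] block_mean_def)
  have A_ind: "indep A ({..<R} \<times> (J \<times> UNIV))"
    using indep_group[OF Z_ind, of "\<lambda>z. z 0 - z 1 * z 2"] by (simp add: A_Z[abs_def])
  have "(\<lambda>z. 1 / card J * (\<Sum>j\<in>J. z (j, False) * z (j, True)))
      \<in> borel_measurable (PiM (J \<times> UNIV) (\<lambda>_. borel :: real measure))"
    by (intro borel_measurable_times borel_measurable_const borel_measurable_sum
        measurable_component_singleton) auto
  from indep_group[OF A_ind this] show "indep T {..<R}"
    by (simp add: T_A[abs_def] cong: sum.cong)

  assume r: "r < R"
  have Z_mom: "E (Z ((r, j, b), c)) = \<mu> j c" "Var (Z ((r, j, b), c)) \<le> 1 / (m * g\<^sup>2)"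
    if "j \<in> J" "c < 3" for j b c
    using moments_mean[OF indep_section[OF ind] m g(1) bounded, of "((r, j, b), c)" "\<mu> j c"]
      mean r that
    by (auto simp: Z_def[abs_def] block_mean_def)
  have A_mom: "E (A (r, j, b)) = \<mu> j 0 - \<mu> j 1 * \<mu> j 2" "Var (A (r, j, b)) \<le> v"
    if j: "j \<in> J" for j b
    using moments_covariance[OF indep_section[OF Z_ind] Z_mom(2)[OF j] g(2), of b]
      r j \<mu>[OF j]
    by (auto simp: A_Z v_def Z_mom(1)[OF j])
  have A_sec: "indep (\<lambda>i. A (r, i)) (J \<times> UNIV)"
    using r by (intro indep_section[OF A_ind]) auto
  note mom = moments_squared_norm[where A = "\<lambda>i. A (r, i)" and a = "\<lambda>j. \<mu> j 0 - \<mu> j 1 * \<mu> j 2",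
      OF A_sec J(1) A_mom]
  show "E (T r) = D"
    unfolding T_A integral_mult_right_zero D_def by (subst mom(1)) auto
  have "Var (T r) \<le> (1 / card J)\<^sup>2 * (card J * v\<^sup>2 + 2 * v * (\<Sum>j\<in>J. (\<mu> j 0 - \<mu> j 1 * \<mu> j 2)\<^sup>2))"
    unfolding T_A Var_cmult by (intro mult_left_mono mom(2)) auto
  also have "\<dots> = (v\<^sup>2 + 2 * v * D) / card J"
    using J by (simp add: D_def power2_eq_square field_simps)
  finally show "Var (T r) \<le> (v\<^sup>2 + 2 * v * D) / card J" .
qed

text \<open>Chebyshev with the threshold halfway between 0 and \<open>\<theta>\<close>: an error
  needs a deviation of \<open>\<theta> / 2\<close> if \<open>D = 0\<close> and of at least
  \<open>D / 2\<close> otherwise. The constant 40 is 4 from the halving times 10 from the error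
  1/10.\<close>

lemma threshold_error:
  assumes mean: "E T = D" and var: "Var T \<le> (v\<^sup>2 + 2 * v * D) / M"
    and pos: "v > 0" "M > 0" "\<theta> > 0"
    and small: "40 * (v\<^sup>2 + 2 * v * \<theta>) \<le> M * \<theta>\<^sup>2"
  shows "D = 0 \<Longrightarrow> measure_pmf.prob Q {w. T w \<in> {\<theta> / 2..}} \<le> 1 / 10"
    and "D \<ge> \<theta> \<Longrightarrow> measure_pmf.prob Q {w. T w \<in> {..<\<theta> / 2}} \<le> 1 / 10"
proof -
  assume D: "D = 0"
  have "measure_pmf.prob Q {w. T w \<in> {\<theta> / 2..}} \<le> measure_pmf.prob Q {w. \<bar>T w - E T\<bar> \<ge> \<theta> / 2}"
    by (intro measure_pmf.finite_measure_mono) (auto simp: mean D)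
  also have "\<dots> \<le> Var T / (\<theta> / 2)\<^sup>2"
    using pos by (intro Chebyshev) auto
  also have "\<dots> \<le> (v\<^sup>2 / M) / (\<theta> / 2)\<^sup>2"
    using var D by (intro divide_right_mono) auto
  also have "\<dots> \<le> 1 / 10"
  proof -
    have "2 * v * \<theta> > 0" using pos by simp
    hence "40 * v\<^sup>2 \<le> M * \<theta>\<^sup>2" using small by (simp add: algebra_simps)
    thus ?thesis using pos by (simp add: field_simps)
  qed
  finally show "measure_pmf.prob Q {w. T w \<in> {\<theta> / 2..}} \<le> 1 / 10" .
next
  assume D: "D \<ge> \<theta>"
  have "measure_pmf.prob Q {w. T w \<in> {..<\<theta> / 2}} \<le> measure_pmf.prob Q {w. \<bar>T w - E T\<bar> \<ge> D / 2}"
    using D by (intro measure_pmf.finite_measure_mono) (auto simp: mean abs_if)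
  also have "\<dots> \<le> Var T / (D / 2)\<^sup>2"
    using pos D by (intro Chebyshev) auto
  also have "\<dots> \<le> ((v\<^sup>2 + 2 * v * D) / M) / (D / 2)\<^sup>2"
    using var by (intro divide_right_mono) auto
  also have "\<dots> \<le> 1 / 10"
  proof -
    \<comment> \<open>The ratio \<open>(v^2 + 2 v D) / D^2\<close> decreases in \<open>D\<close>, so
      \<open>D = \<theta>\<close> is the worst case.\<close>
    have "40 * (v\<^sup>2 + 2 * v * D) * \<theta>\<^sup>2 \<le> 40 * (v\<^sup>2 + 2 * v * \<theta>) * D\<^sup>2"
    proof -
      have "v\<^sup>2 * \<theta>\<^sup>2 \<le> v\<^sup>2 * D\<^sup>2"
        using D pos by (intro mult_left_mono power_mono) auto
      moreover have "(v * D * \<theta>) * \<theta> \<le> (v * D * \<theta>) * D"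
        using D pos by (intro mult_left_mono) auto
      ultimately show ?thesis by (simp add: power2_eq_square algebra_simps)
    qed
    also have "\<dots> \<le> M * \<theta>\<^sup>2 * D\<^sup>2"
      using small by (intro mult_right_mono) auto
    finally have "40 * (v\<^sup>2 + 2 * v * D) \<le> M * D\<^sup>2"
      using pos by (simp add: mult.assoc mult.left_commute[of _ "\<theta>\<^sup>2"] mult.commute[of _ "\<theta>\<^sup>2"])
    thus ?thesis using pos D by (simp add: field_simps)
  qed
  finally show "measure_pmf.prob Q {w. T w \<in> {..<\<theta> / 2}} \<le> 1 / 10" .
qed

end

subsection \<open>Hadamard coefficients\<close>

text \<open>Sylvester's Hadamard matrix of order \<open>2 ^ t\<close>: -1 to the number of common
  ones among the lowest \<open>t\<close> binary digits of \<open>i\<close> and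
  \<open>x\<close>.\<close>

fun hadamard :: "nat \<Rightarrow> nat \<Rightarrow> nat \<Rightarrow> real" where
  "hadamard 0 i x = 1"
| "hadamard (Suc t) i x =
     (if odd i \<and> odd x then -1 else 1) * hadamard t (i div 2) (x div 2)"

lemma abs_hadamard [simp]: "\<bar>hadamard t i x\<bar> = 1"
  by (induction t arbitrary: i x) (auto simp: abs_mult)

text \<open>Summing over the lowest bit of \<open>i\<close> gives the factor \<open>s\<close>, which
  vanishes unless \<open>x\<close> and \<open>y\<close> have equal parity; the remaining bits are
  the induction hypothesis.\<close>

lemma hadamard_orthogonal:
  "x < 2 ^ t \<Longrightarrow> y < 2 ^ t \<Longrightarrow>
    (\<Sum>i<2 ^ t. hadamard t i x * hadamard t i y) = (if x = y then 2 ^ t else 0)"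
proof (induction t arbitrary: x y)
  case 0
  thus ?case by simp
next
  case (Suc t)
  have split: "(\<Sum>i<2 ^ Suc t. f i) = (\<Sum>i<2 ^ t. f (2 * i) + f (2 * i + 1))" for f :: "nat \<Rightarrow> real"
    using sum.nat_group[of f 2 "2 ^ t"] by (simp add: numeral_2_eq_2 mult_ac)
  define s :: real where "s = (if odd x = odd y then 2 else 0)"
  have "(\<Sum>i<2 ^ Suc t. hadamard (Suc t) i x * hadamard (Suc t) i y)
      = (\<Sum>i<2 ^ t. s * (hadamard t i (x div 2) * hadamard t i (y div 2)))"
    unfolding split by (intro sum.cong) (auto simp: s_def)
  also have "\<dots> = s * (if x div 2 = y div 2 then 2 ^ t else 0)"
    using Suc.prems unfolding sum_distrib_left[symmetric] by (subst Suc.IH) auto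
  also have "\<dots> = (if x = y then 2 ^ Suc t else 0)"
  proof -
    have "x = y \<longleftrightarrow> odd x = odd y \<and> x div 2 = y div 2"
      by (metis bit_eq_rec)
    thus ?thesis by (auto simp: s_def)
  qed
  finally show ?case .
qed

text \<open>After expanding the squares and summing over \<open>j\<close> first, only the diagonal
  survives. Orthogonality is required on \<open>S\<close> only, so \<open>square k\<close> may be
  smaller than the full Hadamard grid.\<close>

lemma parseval:
  fixes H :: "'j \<Rightarrow> 'x \<Rightarrow> real"
  assumes "finite S" "\<And>x y. x \<in> S \<Longrightarrow> y \<in> S \<Longrightarrow> (\<Sum>j\<in>J. H j x * H j y) = (if x = y then c else 0)"
  shows "(\<Sum>j\<in>J. (\<Sum>x\<in>S. d x * H j x)\<^sup>2) = c * (\<Sum>x\<in>S. (d x)\<^sup>2)"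
proof -
  have "(\<Sum>j\<in>J. (\<Sum>x\<in>S. d x * H j x)\<^sup>2)
      = (\<Sum>j\<in>J. \<Sum>x\<in>S. \<Sum>y\<in>S. d x * d y * (H j x * H j y))"
    by (simp add: power2_eq_square sum_product mult_ac)
  also have "\<dots> = (\<Sum>x\<in>S. \<Sum>y\<in>S. \<Sum>j\<in>J. d x * d y * (H j x * H j y))"
    by (subst sum.swap, intro sum.cong refl, subst sum.swap, rule refl)
  also have "\<dots> = (\<Sum>x\<in>S. \<Sum>y\<in>S. d x * d y * (if x = y then c else 0))"
    using assms(2) by (simp add: sum_distrib_left[symmetric])
  also have "\<dots> = c * (\<Sum>x\<in>S. (d x)\<^sup>2)"
    using assms(1) by (simp add: if_distrib sum_distrib_left power2_eq_square mult_ac cong: if_cong)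
  finally show ?thesis .
qed

subsection \<open>The private tester\<close>

definition bit_sign :: "bool \<Rightarrow> real" where
  "bit_sign y = (if y then 1 else -1)"

definition randomized_response :: "real \<Rightarrow> ('x \<Rightarrow> real) \<Rightarrow> 'x \<Rightarrow> bool pmf" where
  "randomized_response g \<phi> x = bernoulli_pmf ((1 + g * \<phi> x) / 2)"

text \<open>Both outputs have probability between \<open>(1 - \<rho> / 3) / 2\<close> and
  \<open>(1 + \<rho> / 3) / 2\<close>. The ratio of these is at most \<open>1 + \<rho>\<close>,
  hence at most \<open>exp \<rho>\<close>; 1/3 is the largest factor for which the comparison with
  \<open>1 + \<rho>\<close> holds up to \<open>\<rho> = 1\<close>.\<close>

lemma ldp_randomized_response:
  assumes "0 < \<rho>" "\<rho> \<le> 1" "\<And>x. \<bar>\<phi> x\<bar> = 1"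
  shows "ldp \<rho> A (randomized_response (\<rho> / 3) \<phi>)"
  unfolding ldp_def
proof (intro ballI allI)
  fix x x' y
  define q where "q x = (1 + \<rho> / 3 * \<phi> x) / 2" for x
  have q: "(1 - \<rho> / 3) / 2 \<le> q x" "q x \<le> (1 + \<rho> / 3) / 2" for x
    using assms(1) assms(3)[of x] by (auto simp: q_def abs_if split: if_splits)
  have "\<rho> * \<rho> \<le> \<rho>"
    using assms(1,2) mult_left_mono[of \<rho> 1 \<rho>] by simp
  hence "(1 + \<rho> / 3) / 2 \<le> (1 + \<rho>) * ((1 - \<rho> / 3) / 2)"
    by (simp add: field_simps)
  also have "\<dots> \<le> exp \<rho> * ((1 - \<rho> / 3) / 2)"
    using assms(1,2) by (intro mult_right_mono exp_ge_add_one_self) auto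
  finally have key: "(1 + \<rho> / 3) / 2 \<le> exp \<rho> * ((1 - \<rho> / 3) / 2)" .
  have pmf_bounds: "(1 - \<rho> / 3) / 2 \<le> pmf (randomized_response (\<rho> / 3) \<phi> x) y"
    "pmf (randomized_response (\<rho> / 3) \<phi> x) y \<le> (1 + \<rho> / 3) / 2" for x
  proof -
    have "0 \<le> q x" "q x \<le> 1" using q[of x] assms(1,2) by auto
    hence "pmf (randomized_response (\<rho> / 3) \<phi> x) y = (if y then q x else 1 - q x)"
      by (cases y) (auto simp: randomized_response_def q_def)
    thus "(1 - \<rho> / 3) / 2 \<le> pmf (randomized_response (\<rho> / 3) \<phi> x) y"
      "pmf (randomized_response (\<rho> / 3) \<phi> x) y \<le> (1 + \<rho> / 3) / 2"
      using q[of x] by (auto simp: field_simps)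
  qed
  have "exp \<rho> * ((1 - \<rho> / 3) / 2) \<le> exp \<rho> * pmf (randomized_response (\<rho> / 3) \<phi> x) y"
    using pmf_bounds(1)[of x] by (intro mult_left_mono) auto
  thus "pmf (randomized_response (\<rho> / 3) \<phi> x') y
      \<le> exp \<rho> * pmf (randomized_response (\<rho> / 3) \<phi> x) y"
    using pmf_bounds(2)[of x'] key by linarith
qed

lemma expectation_sign_randomized_response:
  fixes g :: real
  assumes "finite (set_pmf p)" "0 \<le> g" "g \<le> 1" "\<And>x. \<bar>\<phi> x\<bar> = 1"
  shows "measure_pmf.expectation (bind_pmf p (randomized_response g \<phi>)) bit_sign
    = g * measure_pmf.expectation p \<phi>"
proof -
  have "measure_pmf.expectation (randomized_response g \<phi> x) bit_sign = g * \<phi> x" for x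
  proof -
    have "0 \<le> (1 + g * \<phi> x) / 2" "(1 + g * \<phi> x) / 2 \<le> 1"
      using assms(2,3) assms(4)[of x] by (auto simp: abs_if split: if_splits)
    thus ?thesis
      by (simp add: randomized_response_def bit_sign_def field_simps)
  qed
  moreover have "measure_pmf.expectation (bind_pmf p (randomized_response g \<phi>)) bit_sign
      = (\<Sum>x\<in>set_pmf p. pmf p x *\<^sub>R measure_pmf.expectation (randomized_response g \<phi> x) bit_sign)"
    using assms(1) by (intro pmf_expectation_bind) (auto intro: finite_subset[OF subset_UNIV])
  moreover have "measure_pmf.expectation p \<phi> = (\<Sum>x\<in>set_pmf p. \<phi> x * pmf p x)"
    using assms(1) by (intro integral_measure_pmf_real) auto
  ultimately show ?thesis by (simp add: sum_distrib_left mult_ac)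
qed

text \<open>Seeds that are ignored integrate out, and sampling followed by the channel merges
  coordinatewise, so the messages are independent with explicit laws.\<close>

lemma run_protocol_seedless:
  "run_protocol n \<lparr>coins = c, channel = \<lambda>i _. W i, referee = ref\<rparr> p
    = bind_pmf (Pi_pmf {1..n} undefined (\<lambda>i. bind_pmf p (W i))) ref"
  unfolding run_protocol_def
  \<comment> \<open>The default value is that of the intermediate sample vector in
    \<open>run_protocol\<close>.\<close>
  by (subst Pi_pmf_bind[where d' = undefined]) (simp_all add: bind_assoc_pmf)

text \<open>The map \<open>f\<close> assigns players to the structured indices used in the analysis;
  injectivity means that distinct indices read distinct coordinates.\<close>

lemma indep_signs:
  assumes "finite I" "inj_on f A" "f ` A \<subseteq> I"
  shows "prob_space.indep_vars (measure_pmf (Pi_pmf I d p)) (\<lambda>_. borel) (\<lambda>a w. bit_sign (w (f a))) A"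
proof -
  have "prob_space.indep_vars (measure_pmf (Pi_pmf I d p)) (\<lambda>a. PiM {f a} (\<lambda>_. count_space UNIV))
      (\<lambda>a w. \<lambda>i\<in>{f a}. w i) A"
    using assms
    by (intro prob_space.indep_vars_restrict[OF prob_space_measure_pmf indep_vars_Pi_pmf])
      (auto simp: disjoint_family_on_def inj_on_def)
  hence "prob_space.indep_vars (measure_pmf (Pi_pmf I d p)) (\<lambda>_. borel)
      (\<lambda>a w. bit_sign ((\<lambda>i\<in>{f a}. w i) (f a))) A"
    by (rule prob_space.indep_vars_compose2[OF prob_space_measure_pmf, where Y = "\<lambda>a z. bit_sign (z (f a))"])
      (auto intro!: measurable_compose[OF measurable_component_singleton])
  thus ?thesis by simp
qed

section \<open>Fourier coefficients and distance from products\<close>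

text \<open>The roles \<open>c = 0, 1, 2\<close> estimate the joint and the two marginal Fourier coefficients.\<close>

definition character :: "nat \<Rightarrow> nat \<times> nat \<Rightarrow> nat \<Rightarrow> nat \<times> nat \<Rightarrow> real" where
  "character t j c x =
     (if c = 0 then hadamard t (fst j) (fst x) * hadamard t (snd j) (snd x)
      else if c = 1 then hadamard t (fst j) (fst x) else hadamard t (snd j) (snd x))"

lemma abs_character [simp]: "\<bar>character t j c x\<bar> = 1"
  by (simp add: character_def abs_mult)

definition coefficient :: "nat \<Rightarrow> (nat \<times> nat) pmf \<Rightarrow> nat \<times> nat \<Rightarrow> nat \<Rightarrow> real" where
  "coefficient t p j c = measure_pmf.expectation p (character t j c)"

lemma finite_square [simp]: "finite (square k)"
  by (simp add: square_def)

text \<open>The product of the marginal expectations is the expectation of the product character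
  under the product of the marginals, so the covariance is a Hadamard coefficient of the
  difference.\<close>

lemma coefficient_difference:
  assumes "p \<in> distributions (square k)"
  shows "coefficient t p j 0 - coefficient t p j 1 * coefficient t p j 2
    = (\<Sum>x\<in>square k. (pmf p x - pmf (pair_pmf (map_pmf fst p) (map_pmf snd p)) x) * character t j 0 x)"
proof -
  have supp: "set_pmf p \<subseteq> square k" using assms by (simp add: distributions_def)
  let ?h1 = "hadamard t (fst j)" and ?h2 = "hadamard t (snd j)"
  have c0: "coefficient t p j 0 = (\<Sum>x\<in>square k. character t j 0 x * pmf p x)"
    unfolding coefficient_def using supp by (intro integral_measure_pmf_real) auto
  have "coefficient t p j 1 = measure_pmf.expectation (map_pmf fst p) ?h1"
    by (simp add: coefficient_def character_def[abs_def])
  also have "\<dots> = (\<Sum>a\<in>{1..k}. ?h1 a * pmf (map_pmf fst p) a)"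
    using supp by (intro integral_measure_pmf_real) (auto simp: square_def)
  finally have c1: "coefficient t p j 1 = (\<Sum>a\<in>{1..k}. ?h1 a * pmf (map_pmf fst p) a)" .
  have "coefficient t p j 2 = measure_pmf.expectation (map_pmf snd p) ?h2"
    by (simp add: coefficient_def character_def[abs_def])
  also have "\<dots> = (\<Sum>b\<in>{1..k}. ?h2 b * pmf (map_pmf snd p) b)"
    using supp by (intro integral_measure_pmf_real) (auto simp: square_def)
  finally have c2: "coefficient t p j 2 = (\<Sum>b\<in>{1..k}. ?h2 b * pmf (map_pmf snd p) b)" .
  have "coefficient t p j 1 * coefficient t p j 2
      = (\<Sum>x\<in>square k. pmf (pair_pmf (map_pmf fst p) (map_pmf snd p)) x * character t j 0 x)"
    unfolding c1 c2 sum_product square_def sum.cartesian_product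
    by (intro sum.cong) (auto simp: pmf_pair character_def)
  thus ?thesis
    unfolding c0 by (simp add: algebra_simps sum_subtractf)
qed

lemma sum_coefficient_difference:
  assumes p: "p \<in> distributions (square k)" and k: "k < 2 ^ t"
  shows "(\<Sum>j\<in>{..<2 ^ t} \<times> {..<2 ^ t}.
        (coefficient t p j 0 - coefficient t p j 1 * coefficient t p j 2)\<^sup>2)
    = (2 ^ t)\<^sup>2 * (\<Sum>x\<in>square k. (pmf p x - pmf (pair_pmf (map_pmf fst p) (map_pmf snd p)) x)\<^sup>2)"
  unfolding coefficient_difference[OF p]
proof (rule parseval)
  fix x y assume "x \<in> square k" "y \<in> square k"
  \<comment> \<open>Strictness of \<open>k < 2 ^ t\<close> matters here: points are numbered from 1,
    Hadamard columns from 0.\<close>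
  hence lt: "fst x < 2 ^ t" "snd x < 2 ^ t" "fst y < 2 ^ t" "snd y < 2 ^ t"
    using k by (auto simp: square_def)
  have "(\<Sum>j\<in>{..<2 ^ t} \<times> {..<2 ^ t}. character t j 0 x * character t j 0 y)
      = (\<Sum>i<2 ^ t. hadamard t i (fst x) * hadamard t i (fst y)) *
        (\<Sum>i<2 ^ t. hadamard t i (snd x) * hadamard t i (snd y))"
    unfolding sum_product sum.cartesian_product
    by (intro sum.cong) (auto simp: character_def)
  also have "\<dots> = (if x = y then (2 ^ t)\<^sup>2 else 0)"
    using lt by (auto simp: hadamard_orthogonal power2_eq_square prod_eq_iff)
  finally show "(\<Sum>j\<in>{..<2 ^ t} \<times> {..<2 ^ t}. character t j 0 x * character t j 0 y)
      = (if x = y then (2 ^ t)\<^sup>2 else 0)" .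
qed simp

text \<open>The product of the marginals of \<open>p\<close> competes in the infimum, so its L1
  distance from \<open>p\<close> exceeds \<open>2 * \<epsilon>\<close>; Cauchy-Schwarz over the
  \<open>k^2\<close> points does the rest.\<close>

lemma far_imp_sum_squares:
  assumes p: "p \<in> distributions (square k)" and far: "dist_to_products k p > \<epsilon>" and \<epsilon>: "\<epsilon> > 0"
  shows "4 * \<epsilon>\<^sup>2 / (real k)\<^sup>2
    \<le> (\<Sum>x\<in>square k. (pmf p x - pmf (pair_pmf (map_pmf fst p) (map_pmf snd p)) x)\<^sup>2)"
proof -
  let ?q1 = "map_pmf fst p" and ?q2 = "map_pmf snd p"
  let ?d = "\<lambda>x. \<bar>pmf p x - pmf (pair_pmf ?q1 ?q2) x\<bar>"
  have "(?q1, ?q2) \<in> distributions {1..k} \<times> distributions {1..k}"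
    using p by (auto simp: distributions_def square_def)
  hence "dist_to_products k p \<le> (case (?q1, ?q2) of (q1, q2) \<Rightarrow> tv_dist (square k) p (pair_pmf q1 q2))"
    unfolding dist_to_products_def
    by (intro cINF_lower) (auto intro!: bdd_belowI[of _ 0] simp: tv_dist_def sum_nonneg)
  hence "2 * \<epsilon> \<le> (\<Sum>x\<in>square k. ?d x)"
    using far by (simp add: tv_dist_def)
  hence "(2 * \<epsilon>)\<^sup>2 \<le> (\<Sum>x\<in>square k. ?d x * 1)\<^sup>2"
    using \<epsilon> by (intro power_mono) auto
  also have "\<dots> \<le> (\<Sum>x\<in>square k. (?d x)\<^sup>2) * (\<Sum>x\<in>square k. 1\<^sup>2)"
    by (rule Cauchy_Schwarz_ineq_sum)
  also have "\<dots> = (real k)\<^sup>2 * (\<Sum>x\<in>square k. (pmf p x - pmf (pair_pmf ?q1 ?q2) x)\<^sup>2)"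
    by (simp add: square_def power2_eq_square)
  finally have "4 * \<epsilon>\<^sup>2 \<le> (real k)\<^sup>2 * (\<Sum>x\<in>square k. (pmf p x - pmf (pair_pmf ?q1 ?q2) x)\<^sup>2)"
    by (simp add: power_mult_distrib)
  \<comment> \<open>For \<open>k = 0\<close> the left side is 0, as division by zero yields
    0.\<close>
  thus ?thesis
    by (cases "k = 0") (auto simp: field_simps square_def)
qed

text \<open>The bound on \<open>n\<close> counts rounds, coefficients, 2 copies, 3 roles and
  \<open>m\<close> players per block. The referee ignores surplus players.\<close>

lemma independence_tester_correct:
  fixes k n t m R :: nat and \<rho> \<epsilon> :: real
  assumes k: "k \<ge> 1" "k < 2 ^ t"
    and \<rho>: "0 < \<rho>" "\<rho> \<le> 1" and \<epsilon>: "0 < \<epsilon>" "\<epsilon> \<le> 1"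
    and m: "1440 * k / (\<rho>\<^sup>2 * \<epsilon>\<^sup>2) \<le> m"
    and n: "R * (2 ^ t * 2 ^ t * 2) * 3 * m \<le> n"
    and R: "(3 / 5) ^ R < \<delta>"
  shows "\<exists>P :: (nat \<times> nat, nat, bool) protocol.
    ldp_protocol \<rho> (square k) n P \<and> solves_independence_testing k \<epsilon> \<delta> n P"
proof -
  define J where "J = {..<(2::nat) ^ t} \<times> {..<(2::nat) ^ t}"
  define I where "I = (({..<R} \<times> (J \<times> (UNIV :: bool set))) \<times> {..<3::nat}) \<times> {..<m}"
  define g where "g = \<rho> / 3"
  define v where "v = 4 / (m * g\<^sup>2)"
  define \<theta> where "\<theta> = 4 * \<epsilon>\<^sup>2 / (real k)\<^sup>2"
  have J: "finite J" "J \<noteq> {}" and card_J: "card J = (2 ^ t)\<^sup>2"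
    by (auto simp: J_def card_cartesian_product power2_eq_square lessThan_empty_iff)
  have g: "0 < g" "g \<le> 1" using \<rho> by (auto simp: g_def)

  have m_pos: "m > 0"
  proof -
    have "0 < 1440 * k / (\<rho>\<^sup>2 * \<epsilon>\<^sup>2)" using k \<rho> \<epsilon> by simp
    thus ?thesis using m by linarith
  qed
  have v: "v > 0" using m_pos g by (simp add: v_def)
  \<comment> \<open>Since \<open>g = \<rho> / 3\<close>, \<open>v\<close> equals
    \<open>36 / (m * \<rho>^2)\<close>, and 1440 is 36 times 40.\<close>
  have v_le: "v \<le> \<epsilon>\<^sup>2 / (40 * k)"
    using m m_pos k \<rho> \<epsilon> by (simp add: v_def g_def field_simps)
  have \<theta>: "\<theta> > 0" using k \<epsilon> by (simp add: \<theta>_def)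
  have mg: "1 / (m * g\<^sup>2) \<le> 1"
  proof -
    have "\<epsilon>\<^sup>2 \<le> 1" using \<epsilon> by (simp add: abs_square_le_1)
    hence "\<epsilon>\<^sup>2 / (40 * k) \<le> 1" using k by (simp add: field_simps)
    hence "4 * (1 / (m * g\<^sup>2)) \<le> 1" using v_le by (simp add: v_def)
    moreover have "0 \<le> 1 / (m * g\<^sup>2)" by simp
    ultimately show ?thesis by linarith
  qed
  \<comment> \<open>In terms of \<open>e\<close> the left side is at most
    \<open>e^2 / 40 + 8 e^2\<close>, while the right side is at least
    \<open>(\<theta> * k)^2 = 16 e^2\<close> because \<open>card J\<close> is at least
    \<open>k^2\<close>. This is why \<open>m\<close> linear in \<open>k\<close> suffices.\<close>
  have small: "40 * (v\<^sup>2 + 2 * v * \<theta>) \<le> card J * \<theta>\<^sup>2"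
  proof -
    define e where "e = \<epsilon>\<^sup>2 / k"
    have e: "e > 0" using \<epsilon> k by (simp add: e_def)
    have ve: "v \<le> e / 40" using v_le by (simp add: e_def)
    have \<theta>e: "\<theta> * k = 4 * e" using k by (simp add: \<theta>_def e_def power2_eq_square)
    have "\<theta> \<le> 4 * e" unfolding \<theta>e[symmetric] using \<theta> k by simp
    hence "v * \<theta> \<le> e / 40 * (4 * e)" using ve v \<theta> e by (intro mult_mono) auto
    moreover have "v\<^sup>2 \<le> (e / 40)\<^sup>2" using ve v by (intro power_mono) auto
    ultimately have "40 * (v\<^sup>2 + 2 * v * \<theta>) \<le> 16 * e\<^sup>2"
      unfolding power2_eq_square by (simp, use zero_le_square[of e] in linarith)
    also have "16 * e\<^sup>2 = (\<theta> * k)\<^sup>2" unfolding \<theta>e by (simp add: power_mult_distrib)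
    also have "\<dots> = k\<^sup>2 * \<theta>\<^sup>2" by (simp add: power_mult_distrib)
    also have "\<dots> \<le> card J * \<theta>\<^sup>2"
    proof (intro mult_right_mono)
      show "real (k\<^sup>2) \<le> real (card J)"
        unfolding card_J using k by (simp only: of_nat_le_iff) (intro power_mono, auto)
    qed simp
    finally show ?thesis .
  qed

  have "card I \<le> card {1..n}"
    using n by (simp add: I_def J_def card_cartesian_product UNIV_bool algebra_simps)
  moreover have "finite I" by (simp add: I_def J)
  ultimately obtain f where f: "f ` I \<subseteq> {1..n}" "inj_on f I"
    using card_le_inj[of I "{1..n}"] by auto
  \<comment> \<open>Outside the image of \<open>f\<close> the index is arbitrary, but the value is
    still a sign, so surplus players are private too.\<close>
  define \<phi> where "\<phi> i = (case inv_into I f i of (((r, j, b), c), l) \<Rightarrow> character t j c)" for i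
  have abs_\<phi>: "\<bar>\<phi> i x\<bar> = 1" for i x
    by (simp add: \<phi>_def split: prod.split)
  define stat where "stat y r = round_statistic m g J (\<lambda>a. bit_sign (y (f a))) r" for y r
  define accepts where "accepts y \<longleftrightarrow> R < 2 * card {r. r < R \<and> stat y r \<in> {..<\<theta> / 2}}" for y
  \<comment> \<open>The seed is constant: all private randomness is the noise of the
    channel.\<close>
  define P :: "(nat \<times> nat, nat, bool) protocol" where
    "P = \<lparr>coins = \<lambda>_. return_pmf 0, channel = \<lambda>i _. randomized_response g (\<phi> i),
          referee = \<lambda>y. return_pmf (accepts y)\<rparr>"
  have "ldp_protocol \<rho> (square k) n P"
    using \<rho> abs_\<phi> by (auto simp: ldp_protocol_def P_def g_def intro!: ldp_randomized_response)
  moreover have "solves_independence_testing k \<epsilon> \<delta> n P"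
    unfolding solves_independence_testing_def
  proof (intro ballI)
    fix p assume p: "p \<in> distributions (square k)"
    define Q where "Q = Pi_pmf {1..n} undefined (\<lambda>i. bind_pmf p (randomized_response g (\<phi> i)))"
    have run: "run_protocol n P p = map_pmf accepts Q"
      by (simp add: P_def run_protocol_seedless Q_def map_pmf_def)
    have "finite (PiE_dflt {1..n} undefined (\<lambda>_. UNIV :: bool set))"
      by (intro finite_PiE_dflt) auto
    moreover have "set_pmf Q \<subseteq> PiE_dflt {1..n} undefined (\<lambda>_. UNIV)"
      unfolding Q_def by (rule order_trans[OF set_Pi_pmf_subset']) (auto simp: PiE_dflt_def)
    ultimately interpret finite_pmf Q
      by unfold_locales (rule finite_subset)
    define D where "D = 1 / card J *
      (\<Sum>j\<in>J. (coefficient t p j 0 - coefficient t p j 1 * coefficient t p j 2)\<^sup>2)"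
    have D: "D = (\<Sum>x\<in>square k. (pmf p x - pmf (pair_pmf (map_pmf fst p) (map_pmf snd p)) x)\<^sup>2)"
      unfolding D_def J_def[symmetric] sum_coefficient_difference[OF p k(2), folded J_def]
      by (simp add: card_J)
    define Y where "Y a y = bit_sign (y (f a))" for a and y :: "nat \<Rightarrow> bool"
    have ind: "indep Y I"
      unfolding Q_def Y_def[abs_def] using f by (intro indep_signs) auto
    have mean: "E (Y (((r, j, b), c), l)) = g * coefficient t p j c"
      if "r < R" "j \<in> J" "c < 3" "l < m" for r j b c l
    proof -
      let ?a = "(((r, j, b), c), l)"
      have a: "?a \<in> I" using that by (auto simp: I_def)
      hence fa: "f ?a \<in> {1..n}" and "inv_into I f (f ?a) = ?a" using f by auto
      hence \<phi>: "\<phi> (f ?a) = character t j c" by (simp add: \<phi>_def)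
      have "E (Y ?a) = measure_pmf.expectation (map_pmf (\<lambda>y. y (f ?a)) Q) bit_sign"
        by (simp add: Y_def[abs_def])
      also have "map_pmf (\<lambda>y. y (f ?a)) Q = bind_pmf p (randomized_response g (\<phi> (f ?a)))"
        unfolding Q_def using fa by (subst Pi_pmf_component) auto
      also have "measure_pmf.expectation \<dots> bit_sign = g * coefficient t p j c"
        unfolding \<phi> coefficient_def using g p
        by (intro expectation_sign_randomized_response)
          (auto simp: distributions_def intro: finite_subset[OF _ finite_square])
      finally show ?thesis .
    qed
    have coefficient_le: "\<bar>coefficient t p j c\<bar> \<le> 1" for j c
    proof -
      have "\<bar>coefficient t p j c\<bar> \<le> measure_pmf.expectation p (\<lambda>x. \<bar>character t j c x\<bar>)"
        unfolding coefficient_def by (rule integral_abs_bound)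
      thus ?thesis by simp
    qed
    have Y_le: "\<bar>Y a w\<bar> \<le> 1" for a w by (simp add: Y_def bit_sign_def)
    note moments = moments_round_statistic[OF ind[unfolded I_def] J m_pos g(1) mg Y_le mean coefficient_le,
        folded D_def v_def, unfolded Y_def, folded stat_def]
    have stat_ind: "indep (\<lambda>r y. stat y r) {..<R}"
      by (rule moments(1))
    note threshold = threshold_error[OF moments(2,3) v _ \<theta> small]
    have card_J_pos: "0 < real (card J)" by (simp add: card_J)
    have split: "card {r. r < R \<and> stat y r \<in> {..<\<theta> / 2}} + card {r. r < R \<and> stat y r \<in> {\<theta> / 2..}} = R" for y
    proof -
      have "{r. r < R \<and> stat y r \<in> {..<\<theta> / 2}} \<union> {r. r < R \<and> stat y r \<in> {\<theta> / 2..}} = {..<R}"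
        by auto
      moreover have "card ({r. r < R \<and> stat y r \<in> {..<\<theta> / 2}} \<union> {r. r < R \<and> stat y r \<in> {\<theta> / 2..}})
          = card {r. r < R \<and> stat y r \<in> {..<\<theta> / 2}} + card {r. r < R \<and> stat y r \<in> {\<theta> / 2..}}"
        by (rule card_Un_disjoint) auto
      ultimately show ?thesis by simp
    qed
    \<comment> \<open>Ties reject. \<open>majority_error\<close> counts a tie as a failure, so it
      covers both cases.\<close>
    have rejects: "R \<le> 2 * card {r. r < R \<and> stat y r \<in> {\<theta> / 2..}} \<longleftrightarrow> \<not> accepts y" for y
      unfolding accepts_def using split[of y] by linarith
    show "(p = pair_pmf (map_pmf fst p) (map_pmf snd p) \<longrightarrow> pmf (run_protocol n P p) True > 1 - \<delta>) \<and>
      (dist_to_products k p > \<epsilon> \<longrightarrow> pmf (run_protocol n P p) False > 1 - \<delta>)"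
    proof (intro conjI impI)
      assume prod: "p = pair_pmf (map_pmf fst p) (map_pmf snd p)"
      have "D = 0" unfolding D prod[symmetric] by simp
      hence "measure_pmf.prob Q {y. R \<le> 2 * card {r. r < R \<and> stat y r \<in> {\<theta> / 2..}}} \<le> (3 / 5) ^ R"
        using card_J_pos by (intro majority_error stat_ind threshold(1)) auto
      also have "{y. R \<le> 2 * card {r. r < R \<and> stat y r \<in> {\<theta> / 2..}}} = accepts -` {False}"
        unfolding rejects by auto
      finally have "pmf (run_protocol n P p) False \<le> (3 / 5) ^ R"
        by (simp add: run pmf_map)
      thus "pmf (run_protocol n P p) True > 1 - \<delta>"
        using R by (simp add: pmf_False_conv_True)
    next
      assume far: "dist_to_products k p > \<epsilon>"
      have "\<theta> \<le> D" unfolding D \<theta>_def by (rule far_imp_sum_squares[OF p far \<epsilon>(1)])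
      hence "measure_pmf.prob Q {y. R \<le> 2 * card {r. r < R \<and> stat y r \<in> {..<\<theta> / 2}}} \<le> (3 / 5) ^ R"
        using card_J_pos by (intro majority_error stat_ind threshold(2)) auto
      moreover have "measure_pmf.prob Q (accepts -` {True})
          \<le> measure_pmf.prob Q {y. R \<le> 2 * card {r. r < R \<and> stat y r \<in> {..<\<theta> / 2}}}"
        by (intro measure_pmf.finite_measure_mono) (auto simp: accepts_def)
      ultimately have "pmf (run_protocol n P p) True \<le> (3 / 5) ^ R"
        by (simp add: run pmf_map)
      thus "pmf (run_protocol n P p) False > 1 - \<delta>"
        using R by (simp add: pmf_False_conv_True)
    qed
  qed
  ultimately show ?thesis by blast
qed

text \<open>Success probability 1/2 exceeds \<open>1 - \<delta>\<close> for every \<open>n\<close>,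
  and a constant message is private because \<open>exp \<rho>\<close> is at least 1.\<close>

lemma coin_flip_protocol:
  fixes n :: nat
  assumes "0 < \<rho>" "1 / 2 < \<delta>"
  shows "\<exists>P :: (nat \<times> nat, nat, bool) protocol.
    ldp_protocol \<rho> (square k) n P \<and> solves_independence_testing k \<epsilon> \<delta> n P"
proof -
  define P :: "(nat \<times> nat, nat, bool) protocol" where
    "P = \<lparr>coins = \<lambda>_. return_pmf 0, channel = \<lambda>_ _ _. return_pmf True,
          referee = \<lambda>_. bernoulli_pmf (1 / 2)\<rparr>"
  have "ldp_protocol \<rho> (square k) n P"
    using assms mult_right_mono[of 1 "exp \<rho>"] by (auto simp: ldp_protocol_def ldp_def P_def)
  moreover have "run_protocol n P p = bernoulli_pmf (1 / 2)" for p
    by (simp add: run_protocol_def P_def)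
  hence "solves_independence_testing k \<epsilon> \<delta> n P"
    using assms(2) by (simp add: solves_independence_testing_def)
  ultimately show ?thesis by blast
qed

section \<open>Choice of parameters\<close>

lemma power_two_between:
  assumes "k \<ge> (1::nat)"
  shows "\<exists>t. k < 2 ^ t \<and> 2 ^ t \<le> 2 * k"
  using assms
proof (induction k rule: nat_induct_at_least)
  case base
  show ?case by (intro exI[of _ 1]) simp
next
  case (Suc k)
  then obtain t where t: "k < 2 ^ t" "2 ^ t \<le> 2 * k" by blast
  show ?case
  proof (cases "Suc k < 2 ^ t")
    case True
    thus ?thesis using t by (intro exI[of _ t]) auto
  next
    case False
    \<comment> \<open>Here \<open>Suc k\<close> equals \<open>2 ^ t\<close>, so doubling the power
      meets the upper bound exactly.\<close>
    thus ?thesis using t by (intro exI[of _ "Suc t"]) auto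
  qed
qed

theorem theorem5:
  "\<exists>C>0. \<forall>(k::nat) (\<rho>::real) (\<epsilon>::real) (\<delta>::real).
     k \<ge> 1 \<and> 0 < \<rho> \<and> \<rho> \<le> 1 \<and> 0 < \<epsilon> \<and> \<epsilon> \<le> 1 \<and> 0 < \<delta> \<and> \<delta> < 1 \<longrightarrow>
     (let n = nat \<lceil>C * (real k ^ 3 / (\<epsilon>\<^sup>2 * \<rho>\<^sup>2)) * ln (1 / \<delta>)\<rceil>
      in \<exists>P :: (nat \<times> nat, nat, bool) protocol.
           ldp_protocol \<rho> (square k) n P \<and> solves_independence_testing k \<epsilon> \<delta> n P)"
proof (intro exI[of _ "172920 :: real"] conjI allI impI)
  fix k :: nat and \<rho> \<epsilon> \<delta> :: real
  assume "k \<ge> 1 \<and> 0 < \<rho> \<and> \<rho> \<le> 1 \<and> 0 < \<epsilon> \<and> \<epsilon> \<le> 1 \<and> 0 < \<delta> \<and> \<delta> < 1"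
  hence k: "k \<ge> 1" and \<rho>: "0 < \<rho>" "\<rho> \<le> 1" and \<epsilon>: "0 < \<epsilon>" "\<epsilon> \<le> 1" and \<delta>: "0 < \<delta>" "\<delta> < 1"
    by auto
  define L where "L = ln (1 / \<delta>)"
  define n where "n = nat \<lceil>172920 * (real k ^ 3 / (\<epsilon>\<^sup>2 * \<rho>\<^sup>2)) * L\<rceil>"
  have "\<exists>P :: (nat \<times> nat, nat, bool) protocol.
    ldp_protocol \<rho> (square k) n P \<and> solves_independence_testing k \<epsilon> \<delta> n P"
  proof (cases "1 / 2 < \<delta>")
    case True
    thus ?thesis using \<rho> by (intro coin_flip_protocol)
  next
    case False
    obtain t where t: "k < 2 ^ t" "2 ^ t \<le> 2 * k"
      using power_two_between[OF k] by blast
    define B where "B = k / (\<rho>\<^sup>2 * \<epsilon>\<^sup>2)"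
    define m where "m = nat \<lceil>1440 * B\<rceil>"
    define R where "R = nat \<lceil>3 * L\<rceil>"
    \<comment> \<open>\<open>B\<close> at least 1 absorbs the rounding of \<open>m\<close> into
      1441, as \<open>L\<close> at least 1/2 below absorbs that of \<open>R\<close>:
      \<open>3 L + 1\<close> is at most \<open>5 L\<close>.\<close>
    have "\<rho>\<^sup>2 * \<epsilon>\<^sup>2 \<le> 1 * 1"
      using \<rho> \<epsilon> by (intro mult_mono) (auto simp: abs_square_le_1)
    hence B: "B \<ge> 1"
      using k \<rho> \<epsilon> by (simp add: B_def field_simps)
    have "1 - 1 / 2 \<le> ln (2::real)"
      using ln_le_minus_one[of "1 / 2 :: real"] by (simp add: ln_div)
    also have "ln 2 \<le> L"
      unfolding L_def using False \<delta> by (intro ln_mono) (auto simp: field_simps)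
    finally have L: "L \<ge> 1 / 2" by simp
    have m: "1440 * B \<le> m" "m \<le> 1441 * B"
      using B of_int_ceiling_le_add_one[of "1440 * B"] by (simp_all add: m_def, linarith)
    have R: "3 * L \<le> R" "R \<le> 5 * L"
      using L of_int_ceiling_le_add_one[of "3 * L"] by (simp_all add: R_def, linarith)
    have "real (R * (2 ^ t * 2 ^ t * 2) * 3 * m) = R * (real (2 ^ t) * real (2 ^ t)) * 6 * m"
      by simp
    \<comment> \<open>The constant of the theorem is 5 * (2 * 2) * 6 * 1441 = 172920.\<close>
    also have "\<dots> \<le> (5 * L) * (real (2 * k) * real (2 * k)) * 6 * (1441 * B)"
      using R m L B t(2) by (intro mult_mono order_refl mult_nonneg_nonneg of_nat_mono) auto
    also have "\<dots> = 172920 * (real k ^ 3 / (\<epsilon>\<^sup>2 * \<rho>\<^sup>2)) * L"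
      by (simp add: B_def power3_eq_cube mult_ac)
    also have "\<dots> \<le> n"
      unfolding n_def by (rule real_nat_ceiling_ge)
    finally have n: "R * (2 ^ t * 2 ^ t * 2) * 3 * m \<le> n"
      by (simp only: of_nat_le_iff)
    \<comment> \<open>As 3/5 = 1 - 2/5 is at most exp (-2/5) and \<open>R\<close> is at least
      \<open>3 L\<close>, the exponent \<open>2 R / 5\<close> is at least \<open>6 L / 5\<close>,
      strictly more than \<open>L\<close>.\<close>
    have "(3 / 5 :: real) ^ R \<le> exp (- 2 / 5) ^ R"
      using exp_ge_add_one_self[of "- 2 / 5"] by (intro power_mono) auto
    also have "\<dots> = exp (- (2 / 5 * R))"
      by (simp add: exp_of_nat_mult[symmetric] mult.commute)
    also have "\<dots> < exp (- L)"
      using R L by simp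
    also have "\<dots> = \<delta>"
      using \<delta> by (simp add: L_def ln_div)
    finally have "(3 / 5) ^ R < \<delta>" .
    thus ?thesis
      using m(1) by (intro independence_tester_correct[OF k t(1) \<rho> \<epsilon> _ n]) (auto simp: B_def)
  qed
  thus "let n = nat \<lceil>172920 * (real k ^ 3 / (\<epsilon>\<^sup>2 * \<rho>\<^sup>2)) * ln (1 / \<delta>)\<rceil>
      in \<exists>P :: (nat \<times> nat, nat, bool) protocol.
           ldp_protocol \<rho> (square k) n P \<and> solves_independence_testing k \<epsilon> \<delta> n P"
    by (simp add: Let_def n_def L_def)
qed simp

end
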